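(* In the setting described in the context, suppose that Assumptions 1, 2 and 3 (stated in full in the context) hold, and select $b_0<\infty$ such that $0<1/[\inf_{\theta\in(0,\theta_* ),\,x\in\mathcal S}u_\theta(x)]^2\le b_0$. (i) Select $b_1>0$ such that for each $\delta\in(0,\theta_* )$, $\exp(\psi(\theta_*-\delta))\le1-\delta\mu+b_1\delta^2$, where $\mu=\frac{d\psi}{d\theta}(\theta_* )>0$. (ii) Pick $b_2\in(0,\infty)$ such that $$\sup_{x\in\mathcal S,\,\delta\in(0,\theta_* )}E_x\big[\lambda(X_1,\eta_1)^{2\theta_*-\delta}\exp((\theta_*-\delta)\gamma(X_1,\xi_1))\big]\le b_2 .$$ (iii) Select $0<B_1,B_2<\infty$ and $\rho_\Delta,c_\Delta>0$ so that $\rho_\Delta\searrow0$ (as $\Delta\searrow0$), $\rho_\Delta\in(0,\theta_* )$, $c_\Delta=(B_2/B_1)\rho_\Delta^{-(1+1/(2\theta_*-\rho_\Delta))}$, $B_1\rho_\Delta<1$ and $$\frac{b_0b_2\rho_\Delta}{B_2^{2\theta_*-\rho_\Delta}}+\frac{1-\rho_\Delta\mu+b_1\rho_\Delta^2}{(1-B_1\rho_\Delta)^{2\theta_*-\rho_\Delta}}\le1 .$$ Then, with $h_\Delta$, $C$ and $r_{\theta_*}$ as defined in the context, $h_\Delta$ satisfies the Lyapunov inequality on $C$: for every $w=(s,d,x)\in C$, $$E_w\big[r_{\theta_*}(w,W_1)\,h_\Delta(W_1)\big]\le h_\Delta(w),$$ where the expectation is taken over the nominal transition from $W_0=w$ to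 $W_1$.
   Context: Model. $X=(X_n:n\ge 0)$ is a Markov chain with finite state space $\mathcal S$ and transition matrix $(K(x,y):x,y\in\mathcal S)$. $((\xi_n,\eta_n):n\ge1)$ is a sequence of i.i.d. two-dimensional random variables independent of $X$. $\gamma(x,z)$ and $\lambda(x,z)$ ($x\in\mathcal S$, $z\in\mathbb R$) are deterministic real-valued functions, with $\lambda\ge 0$. For $\Delta>0$ let $S_{k+1}=S_k+\gamma(X_{k+1},\xi_{k+1})$, $D_{k+1}=D_k+\Delta\,\lambda(X_{k+1},\eta_{k+1})e^{S_{k+1}}$, and $W_n=(S_n,D_n,X_n)$, a Markov process (nominal dynamics); thus from $W_0=(s,d,x)$, $W_1=(s+\gamma_1,\ d+\Delta\lambda_1e^{s+\gamma_1},\ X_1)$ with $\gamma_1=\gamma(X_1,\xi_1)$, $\lambda_1=\lambda(X_1,\eta_1)$ and $X_1\sim K(x,\cdot)$. Notation. $E_x$ (resp. $E_w$) is nominal expectation given $X_0=x$ (resp. $W_0=w$). Let $\exp(\chi(x,\theta))=E\exp(\theta\gamma(x,\xi_1))$ and $Q_\theta(x,y)=K(x,y)\exp(\chi(y,\theta))$. For $\theta$ such that $\chi(\cdot,\theta)$ is finite, $\exp(\psi(\theta))$ denotes the Perron–Frobenius eigenvalue of $Q_\theta$, with strictly positive eigenvector $u_\theta$ (unique up to scaling): $Q_\theta u_\theta=e^{\psi(\theta)}u_\theta$. Otherwise $\psi(\theta)=\infty$. The scaling is chosen so that $\theta\mapsto u_\theta(x)$ is continuous on $(0,\theta_*]$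 for each $x$. Assumption 1: $X$ is irreducible on the finite state space $\mathcal S$, and $\sup_{x\in\mathcal S,\theta\in\mathcal N}E\exp(\theta\gamma(x,\xi_1))<\infty$ for some neighborhood $\mathcal N$ of the origin. Assumption 2 (Cramér's condition): there exists $\theta_*>0$ with $\psi(\theta_* )=0$, and there exists $\theta>\theta_*$ with $\psi(\theta)<\infty$. Assumption 3: $\sup_{x\in\mathcal S}E_x[\lambda(X_1,\eta_1)^\alpha]<\infty$ for each $\alpha\in(0,\infty)$. Definitions. $$h_\Delta(s,d,x)=\min\Big\{c_\Delta^{2\theta_*-\rho_\Delta}e^{(2\theta_*-\rho_\Delta)s}\Big[\frac{\Delta}{(1-d)_+}\Big]^{2\theta_*-\rho_\Delta}u_{\theta_*}(x)u_{\theta_*-\rho_\Delta}(x),\,1\Big\}$$ (equal to $1$ if $d\ge1$), $C=\{(s,d,x):h_\Delta(s,d,x)<1\}$, and $$r_{\theta_*}\big((s_0,d_0,x_0),(s_1,d_1,y)\big)=\begin{cases}\dfrac{u_{\theta_*}(x_0)}{u_{\theta_*}(y)}e^{-\theta_*(s_1-s_0)},&(s_0,d_0,x_0)\in C,\\[2mm]1,&(s_0,d_0,x_0)\notin C.\end{cases}$$ The inequality is asserted for each $\Delta>0$ for which the selections in (iii) are made. *)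

theory Defs
  imports "HOL-Probability.Probability"
begin

section \<open>The Markov-modulated walk\<close>

text \<open>
  The chain \<open>X\<close> is realised in the usual Markovian-family convention: \<open>P x\<close> is the law of
  the whole model given \<open>X\<^sub>0 = x\<close>.  The measure \<open>\<nu>\<close> is the common law of the pairs
  \<open>(\<xi>\<^sub>n, \<eta>\<^sub>n)\<close>, \<open>n \<ge> 1\<close>; the two coordinates of a pair may be dependent.  The values of
  \<open>\<xi>\<close> and \<open>\<eta>\<close> at index 0 are irrelevant.
\<close>

locale nominal_model =
  fixes K :: "real ^ 's ^ 's::finite"
    and \<nu> :: "(real \<times> real) measure"
    and \<gamma> lam :: "'s \<Rightarrow> real \<Rightarrow> real"
    and P :: "'s \<Rightarrow> 'w measure"
    and X :: "nat \<Rightarrow> 'w \<Rightarrow> 's"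
    and \<xi> \<eta> :: "nat \<Rightarrow> 'w \<Rightarrow> real"
  assumes K_nonneg: "\<And>x y. 0 \<le> K $ x $ y"
    and K_row_sum: "\<And>x. (\<Sum>y\<in>UNIV. K $ x $ y) = 1"
    and gamma_measurable: "\<And>x. \<gamma> x \<in> borel_measurable borel"
    and lam_measurable: "\<And>x. lam x \<in> borel_measurable borel"
    and lam_nonneg: "\<And>x z. 0 \<le> lam x z"
    and prob_space_P: "\<And>x. prob_space (P x)"
    and X_measurable: "\<And>x n. X n \<in> measurable (P x) (count_space UNIV)"
    and X_markov: "\<And>x n p. measure (P x) {\<omega> \<in> space (P x). \<forall>i\<le>n. X i \<omega> = p i} =
           (if p 0 = x then \<Prod>i<n. K $ p i $ p (Suc i) else 0)"
    and noise_law: "\<And>x n. n \<ge> 1 \<Longrightarrow> distr (P x) borel (\<lambda>\<omega>. (\<xi> n \<omega>, \<eta> n \<omega>)) = \<nu>"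
    and noise_indep: "\<And>x. prob_space.indep_vars (P x) (\<lambda>_. borel)
           (\<lambda>n \<omega>. (\<xi> n \<omega>, \<eta> n \<omega>)) {1..}"
    and noise_indep_X: "\<And>x. prob_space.indep_set (P x)
           (sets (vimage_algebra (space (P x)) (\<lambda>\<omega> n. X n \<omega>) (Pi\<^sub>M UNIV (\<lambda>_. count_space UNIV))))
           (sets (vimage_algebra (space (P x)) (\<lambda>\<omega>. \<lambda>n\<in>{1..}. (\<xi> n \<omega>, \<eta> n \<omega>))
              (Pi\<^sub>M {1..} (\<lambda>_. borel))))"

text \<open>The components of \<open>W\<^sub>n = (S\<^sub>n, D\<^sub>n, X\<^sub>n)\<close> started from \<open>S\<^sub>0 = s\<close>, \<open>D\<^sub>0 = d\<close>.\<close>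

primrec walk_S :: "('s \<Rightarrow> real \<Rightarrow> real) \<Rightarrow> (nat \<Rightarrow> 'w \<Rightarrow> 's) \<Rightarrow> (nat \<Rightarrow> 'w \<Rightarrow> real) \<Rightarrow>
    real \<Rightarrow> nat \<Rightarrow> 'w \<Rightarrow> real" where
  "walk_S \<gamma> X \<xi> s 0 \<omega> = s"
| "walk_S \<gamma> X \<xi> s (Suc k) \<omega> = walk_S \<gamma> X \<xi> s k \<omega> + \<gamma> (X (Suc k) \<omega>) (\<xi> (Suc k) \<omega>)"

primrec walk_D :: "('s \<Rightarrow> real \<Rightarrow> real) \<Rightarrow> ('s \<Rightarrow> real \<Rightarrow> real) \<Rightarrow> (nat \<Rightarrow> 'w \<Rightarrow> 's) \<Rightarrow>
    (nat \<Rightarrow> 'w \<Rightarrow> real) \<Rightarrow> (nat \<Rightarrow> 'w \<Rightarrow> real) \<Rightarrow> real \<Rightarrow> real \<Rightarrow> real \<Rightarrow> nat \<Rightarrow> 'w \<Rightarrow> real" where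
  "walk_D \<gamma> lam X \<xi> \<eta> \<Delta> s d 0 \<omega> = d"
| "walk_D \<gamma> lam X \<xi> \<eta> \<Delta> s d (Suc k) \<omega> = walk_D \<gamma> lam X \<xi> \<eta> \<Delta> s d k \<omega>
     + \<Delta> * lam (X (Suc k) \<omega>) (\<eta> (Suc k) \<omega>) * exp (walk_S \<gamma> X \<xi> s (Suc k) \<omega>)"

definition walk_W :: "('s \<Rightarrow> real \<Rightarrow> real) \<Rightarrow> ('s \<Rightarrow> real \<Rightarrow> real) \<Rightarrow> (nat \<Rightarrow> 'w \<Rightarrow> 's) \<Rightarrow>
    (nat \<Rightarrow> 'w \<Rightarrow> real) \<Rightarrow> (nat \<Rightarrow> 'w \<Rightarrow> real) \<Rightarrow> real \<Rightarrow> real \<Rightarrow> real \<Rightarrow> nat \<Rightarrow> 'w \<Rightarrow>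
    real \<times> real \<times> 's" where
  "walk_W \<gamma> lam X \<xi> \<eta> \<Delta> s d n \<omega> =
     (walk_S \<gamma> X \<xi> s n \<omega>, walk_D \<gamma> lam X \<xi> \<eta> \<Delta> s d n \<omega>, X n \<omega>)"

definition irreducible_chain :: "real ^ 's ^ 's::finite \<Rightarrow> bool" where
  "irreducible_chain K \<longleftrightarrow> (\<forall>x y. \<exists>n. (((**) K) ^^ n) (mat 1) $ x $ y > 0)"

section \<open>Exponential moments and the Perron-Frobenius data\<close>

definition mgf :: "(real \<times> real) measure \<Rightarrow> ('s \<Rightarrow> real \<Rightarrow> real) \<Rightarrow> 's \<Rightarrow> real \<Rightarrow> ennreal" where
  "mgf \<nu> \<gamma> x \<theta> = (\<integral>\<^sup>+ z. ennreal (exp (\<theta> * \<gamma> x (fst z))) \<partial>\<nu>)"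

definition chi :: "(real \<times> real) measure \<Rightarrow> ('s \<Rightarrow> real \<Rightarrow> real) \<Rightarrow> 's \<Rightarrow> real \<Rightarrow> ereal" where
  "chi \<nu> \<gamma> x \<theta> = (if mgf \<nu> \<gamma> x \<theta> < \<infinity> then ereal (ln (enn2real (mgf \<nu> \<gamma> x \<theta>))) else \<infinity>)"

text \<open>Meaningful only where \<open>chi\<close> is finite.\<close>

definition tilted_kernel :: "real ^ 's ^ 's::finite \<Rightarrow> (real \<times> real) measure \<Rightarrow>
    ('s \<Rightarrow> real \<Rightarrow> real) \<Rightarrow> real \<Rightarrow> real ^ 's ^ 's" where
  "tilted_kernel K \<nu> \<gamma> \<theta> = (\<chi> x y. K $ x $ y * exp (real_of_ereal (chi \<nu> \<gamma> y \<theta>)))"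

definition complex_eigenvalues :: "real ^ 's ^ 's::finite \<Rightarrow> complex set" where
  "complex_eigenvalues A =
     {z. \<exists>v::complex ^ 's. v \<noteq> 0 \<and> (\<chi> x y. complex_of_real (A $ x $ y)) *v v = z *s v}"

text \<open>
  The Perron-Frobenius eigenvalue of an irreducible non-negative matrix is its spectral radius.
\<close>

definition PF_eigenvalue :: "real ^ 's ^ 's::finite \<Rightarrow> real" where
  "PF_eigenvalue A = Max (cmod ` complex_eigenvalues A)"

definition psi :: "real ^ 's ^ 's::finite \<Rightarrow> (real \<times> real) measure \<Rightarrow>
    ('s \<Rightarrow> real \<Rightarrow> real) \<Rightarrow> real \<Rightarrow> ereal" where
  "psi K \<nu> \<gamma> \<theta> = (if \<forall>x. chi \<nu> \<gamma> x \<theta> < \<infinity>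
     then ereal (ln (PF_eigenvalue (tilted_kernel K \<nu> \<gamma> \<theta>))) else \<infinity>)"

text \<open>
  A choice of the eigenvectors \<open>u\<^sub>\<theta>\<close>; as each is determined up to scaling only, the choice
  is a parameter.
\<close>

definition PF_eigenvectors :: "real ^ 's ^ 's::finite \<Rightarrow> (real \<times> real) measure \<Rightarrow>
    ('s \<Rightarrow> real \<Rightarrow> real) \<Rightarrow> real \<Rightarrow> (real \<Rightarrow> real ^ 's) \<Rightarrow> bool" where
  "PF_eigenvectors K \<nu> \<gamma> \<theta>s u \<longleftrightarrow>
     (\<forall>\<theta>. (\<forall>x. chi \<nu> \<gamma> x \<theta> < \<infinity>) \<longrightarrow>
        (\<forall>x. 0 < u \<theta> $ x) \<and>
        tilted_kernel K \<nu> \<gamma> \<theta> *v u \<theta> = exp (real_of_ereal (psi K \<nu> \<gamma> \<theta>)) *s u \<theta>) \<and>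
     (\<forall>x. continuous_on {0<..\<theta>s} (\<lambda>\<theta>. u \<theta> $ x))"

section \<open>The Lyapunov function and the likelihood ratio\<close>

text \<open>
  The case \<open>d \<ge> 1\<close> is separate because \<open>\<Delta> / (1 - d)\<^sub>+\<close> is then infinite, whereas
  division by zero yields \<open>0\<close>.  The arguments \<open>\<rho>\<close> and \<open>c\<close> are the values at \<open>\<Delta>\<close> of the
  functions \<open>\<rho>\<^sub>\<Delta>\<close> and \<open>c\<^sub>\<Delta>\<close>.
\<close>

definition lyap_h :: "(real \<Rightarrow> real ^ 's) \<Rightarrow> real \<Rightarrow> real \<Rightarrow> real \<Rightarrow> real \<Rightarrow>
    real \<times> real \<times> 's::finite \<Rightarrow> real" where
  "lyap_h u \<theta>s \<rho> c \<Delta> = (\<lambda>(s, d, x).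
     if d \<ge> 1 then 1
     else min (c powr (2 * \<theta>s - \<rho>) * exp ((2 * \<theta>s - \<rho>) * s)
               * (\<Delta> / max (1 - d) 0) powr (2 * \<theta>s - \<rho>)
               * (u \<theta>s $ x) * (u (\<theta>s - \<rho>) $ x)) 1)"

definition region_C :: "(real \<Rightarrow> real ^ 's) \<Rightarrow> real \<Rightarrow> real \<Rightarrow> real \<Rightarrow> real \<Rightarrow>
    (real \<times> real \<times> 's::finite) set" where
  "region_C u \<theta>s \<rho> c \<Delta> = {w. lyap_h u \<theta>s \<rho> c \<Delta> w < 1}"

definition ratio_r :: "(real \<Rightarrow> real ^ 's) \<Rightarrow> real \<Rightarrow> real \<Rightarrow> real \<Rightarrow> real \<Rightarrow>
    real \<times> real \<times> 's::finite \<Rightarrow> real \<times> real \<times> 's \<Rightarrow> real" where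
  "ratio_r u \<theta>s \<rho> c \<Delta> = (\<lambda>(s0, d0, x0) (s1, d1, y).
     if (s0, d0, x0) \<in> region_C u \<theta>s \<rho> c \<Delta>
     then (u \<theta>s $ x0) / (u \<theta>s $ y) * exp (- \<theta>s * (s1 - s0))
     else 1)"

end

theory Submission
  imports Defs
begin

text \<open>
  Write \<open>\<alpha> = 2 * \<theta>s - \<rho>\<close>, \<open>A = c * exp s * \<Delta> / (1 - d)\<close> and
  \<open>t = \<Delta> * \<lambda>\<^sub>1 * exp (s + \<gamma>\<^sub>1) / (1 - d)\<close>, the fraction of the remaining distance \<open>1 - d\<close> that the
  next step of \<open>D\<close> covers.  At \<open>w = (s, d, x) \<in> C\<close> the Lyapunov function is the uncapped product
  \<open>A\<^sup>\<alpha> * u\<^sub>\<theta>\<^sub>s(x) * u\<^sub>\<theta>\<^sub>s\<^sub>-\<^sub>\<rho>(x)\<close>.  The step is split according to whether \<open>t\<close> reaches the threshold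
  \<open>\<beta> = B1 * \<rho>\<close>.

  A large jump (\<open>t \<ge> \<beta>\<close>) is controlled by the cap: \<open>h \<le> 1 \<le> (t / \<beta>)\<^sup>\<alpha>\<close>, and, \<open>t / \<beta>\<close> being
  \<open>A * \<lambda>\<^sub>1 * exp \<gamma>\<^sub>1 / (c * \<beta>)\<close>, the likelihood ratio turns the exponent \<open>\<alpha>\<close> of \<open>exp \<gamma>\<^sub>1\<close> into
  \<open>\<theta>s - \<rho>\<close>, so that the moment bound \<open>b2\<close> applies.  The form of \<open>c\<close> is chosen to make
  \<open>(c * \<beta>)\<^sup>\<alpha> = B2\<^sup>\<alpha> / \<rho>\<close>, which gives the term \<open>b0 * b2 * \<rho> / B2\<^sup>\<alpha>\<close>; the constant \<open>b0\<close> pays for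
  replacing \<open>1 / u\<^sub>\<theta>\<^sub>s(X\<^sub>1)\<close> by a multiple of \<open>u\<^sub>\<theta>\<^sub>s\<^sub>-\<^sub>\<rho>(x)\<close>.

  A small jump (\<open>t < \<beta>\<close>) leaves \<open>1 - d\<^sub>1 \<ge> (1 - d) * (1 - \<beta>)\<close>, so up to the factor
  \<open>(1 - \<beta>) powr (- \<alpha>)\<close> the uncapped product gains the factor
  \<open>exp (\<alpha> * \<gamma>\<^sub>1)\<close> and has its eigenvectors evaluated at \<open>X\<^sub>1\<close>.  After multiplication by the
  likelihood ratio what remains is the expectation of \<open>exp ((\<theta>s - \<rho>) * \<gamma>\<^sub>1) * u\<^sub>\<theta>\<^sub>s\<^sub>-\<^sub>\<rho>(X\<^sub>1)\<close>, which
  the eigenvector equation evaluates as \<open>exp (\<psi> (\<theta>s - \<rho>)) * u\<^sub>\<theta>\<^sub>s\<^sub>-\<^sub>\<rho>(x)\<close>.  By the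
  quadratic bound on \<open>exp (\<psi> (\<theta>s - \<rho>))\<close> and the selection inequality, the two contributions add up
  to at most \<open>h w\<close>.

  The split is made pointwise in \<open>lyap_h_step_le\<close>.  The expectation of the small-jump part is
  \<open>PF_eigenvector_expectation\<close>, which rests on the one-step formula \<open>nn_integral_one_step\<close>, and the
  eigenvector factors are bounded below by \<open>eigenvector_ge_Inf\<close>.
\<close>

section \<open>The one-step transition\<close>

context nominal_model
begin

lemma noise_measurable:
  assumes "n \<ge> 1"
  shows "(\<lambda>\<omega>. (\<xi> n \<omega>, \<eta> n \<omega>)) \<in> borel_measurable (P x)"
proof -
  interpret prob_space "P x" by (rule prob_space_P)
  from noise_indep[of x] assms show ?thesis
    unfolding indep_vars_def by auto
qed

lemma prob_space_noise: "prob_space \<nu>"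
proof -
  fix x :: 's
  interpret prob_space "P x" by (rule prob_space_P)
  show ?thesis
    using prob_space_distr[OF noise_measurable[of 1]] noise_law[of 1 x] by simp
qed

lemma sets_noise [measurable_cong]: "sets \<nu> = sets borel"
  using noise_law[of 1] by (metis le_refl sets_distr)

lemma X_event_in_sets: "{\<omega> \<in> space (P x). X n \<omega> = y} \<in> sets (P x)"
proof -
  note X_measurable[measurable]
  have "{\<omega> \<in> space (P x). X n \<omega> = y} = X n -` {y} \<inter> space (P x)" by auto
  then show ?thesis by simp
qed

lemma one_step_probability: "measure (P x) {\<omega> \<in> space (P x). X 1 \<omega> = y} = K $ x $ y"
proof -
  interpret prob_space "P x" by (rule prob_space_P)
  have "measure (P x) {\<omega> \<in> space (P x). X 0 \<omega> = x} = 1"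
    using X_markov[of x 0 "\<lambda>_. x"] by simp
  then have start: "AE \<omega> in P x. X 0 \<omega> = x"
    using prob_eq_1[OF X_event_in_sets[of x 0 x]] by simp
  have path: "{\<omega> \<in> space (P x). \<forall>i\<le>1. X i \<omega> = (if i = 0 then x else y)} =
      {\<omega> \<in> space (P x). X 0 \<omega> = x} \<inter> {\<omega> \<in> space (P x). X 1 \<omega> = y}"
    by (auto simp: le_Suc_eq)
  have "measure (P x) {\<omega> \<in> space (P x). X 1 \<omega> = y} =
      measure (P x) ({\<omega> \<in> space (P x). X 0 \<omega> = x} \<inter> {\<omega> \<in> space (P x). X 1 \<omega> = y})"
  proof (rule finite_measure_eq_AE)
    show "AE \<omega> in P x. (\<omega> \<in> {\<omega> \<in> space (P x). X 1 \<omega> = y}) =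
        (\<omega> \<in> {\<omega> \<in> space (P x). X 0 \<omega> = x} \<inter> {\<omega> \<in> space (P x). X 1 \<omega> = y})"
      using start by eventually_elim auto
  qed (intro sets.Int X_event_in_sets)+
  also have "\<dots> = K $ x $ y"
    using X_markov[of x 1 "\<lambda>i. if i = 0 then x else y"] unfolding path by simp
  finally show ?thesis .
qed

lemma one_step_independence:
  assumes B: "B \<in> sets borel"
  shows "measure (P x) ({\<omega> \<in> space (P x). X 1 \<omega> = y} \<inter>
      ((\<lambda>\<omega>. (\<xi> 1 \<omega>, \<eta> 1 \<omega>)) -` B \<inter> space (P x))) = K $ x $ y * measure \<nu> B"
proof -
  interpret prob_space "P x" by (rule prob_space_P)
  let ?Z = "\<lambda>\<omega>. \<lambda>n\<in>{1::nat..}. (\<xi> n \<omega>, \<eta> n \<omega>)"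
  let ?PX = "Pi\<^sub>M UNIV (\<lambda>_. count_space UNIV) :: (nat \<Rightarrow> 's) measure"
  let ?PZ = "Pi\<^sub>M {1..} (\<lambda>_. borel) :: (nat \<Rightarrow> real \<times> real) measure"
  have "(\<lambda>f. f 1) -` {y} \<inter> space ?PX \<in> sets ?PX"
    by (rule measurable_sets[OF measurable_component_singleton]) auto
  from in_vimage_algebra[OF this, of "\<lambda>\<omega> n. X n \<omega>" "space (P x)"]
  have A: "{\<omega> \<in> space (P x). X 1 \<omega> = y} \<in>
      sets (vimage_algebra (space (P x)) (\<lambda>\<omega> n. X n \<omega>) ?PX)"
    by (rule back_subst) (auto simp: space_PiM)
  have "(\<lambda>f. f 1) -` B \<inter> space ?PZ \<in> sets ?PZ"
    by (rule measurable_sets[OF measurable_component_singleton]) (auto simp: B)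
  from in_vimage_algebra[OF this, of ?Z "space (P x)"]
  have Z: "(\<lambda>\<omega>. (\<xi> 1 \<omega>, \<eta> 1 \<omega>)) -` B \<inter> space (P x) \<in> sets (vimage_algebra (space (P x)) ?Z ?PZ)"
    by (rule back_subst) (auto simp: space_PiM)
  have "measure (P x) ((\<lambda>\<omega>. (\<xi> 1 \<omega>, \<eta> 1 \<omega>)) -` B \<inter> space (P x)) = measure \<nu> B"
    using measure_distr[OF noise_measurable[of 1 x] B] noise_law[of 1 x] by simp
  with indep_setD[OF noise_indep_X A Z] one_step_probability show ?thesis by simp
qed

text \<open>
  The transition rule of the chain driven by the noise: by independence the noise has law \<open>\<nu>\<close> also
  on each event that fixes \<open>X\<^sub>1\<close>, so an expectation over one step may be taken state by state.
\<close>

lemma nn_integral_one_step: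
  assumes g [measurable]: "\<And>y. g y \<in> borel_measurable borel"
  shows "(\<integral>\<^sup>+ \<omega>. g (X 1 \<omega>) (\<xi> 1 \<omega>, \<eta> 1 \<omega>) \<partial>P x) =
    (\<Sum>y\<in>UNIV. ennreal (K $ x $ y) * (\<integral>\<^sup>+ z. g y z \<partial>\<nu>))"
proof -
  interpret prob_space "P x" by (rule prob_space_P)
  interpret N: prob_space \<nu> by (rule prob_space_noise)
  let ?Z = "\<lambda>\<omega>. (\<xi> 1 \<omega>, \<eta> 1 \<omega>)"
  let ?A = "\<lambda>y. {\<omega> \<in> space (P x). X 1 \<omega> = y}"
  note [measurable] = noise_measurable[OF order_refl, of x] X_measurable[of 1 x] X_event_in_sets[of x 1]
  have restrict: "distr (density (P x) (indicator (?A y))) borel ?Z =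
      scale_measure (ennreal (K $ x $ y)) \<nu>" for y
  proof (rule measure_eqI)
    fix B assume "B \<in> sets (distr (density (P x) (indicator (?A y))) borel ?Z)"
    then have B [measurable]: "B \<in> sets borel" by simp
    have "emeasure (distr (density (P x) (indicator (?A y))) borel ?Z) B =
        emeasure (P x) (?A y \<inter> (?Z -` B \<inter> space (P x)))"
      using noise_measurable[OF order_refl, of x] measurable_sets[OF noise_measurable B, of 1 x]
      by (subst emeasure_distr) (simp_all add: emeasure_restricted X_event_in_sets)
    also have "\<dots> = emeasure (scale_measure (ennreal (K $ x $ y)) \<nu>) B"
      using one_step_independence[OF B, of x y] K_nonneg[of x y]
      by (simp add: emeasure_eq_measure N.emeasure_eq_measure ennreal_mult)
    finally show "emeasure (distr (density (P x) (indicator (?A y))) borel ?Z) B =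
        emeasure (scale_measure (ennreal (K $ x $ y)) \<nu>) B" .
  qed (simp add: sets_noise)
  have "(\<integral>\<^sup>+ \<omega>. g (X 1 \<omega>) (?Z \<omega>) \<partial>P x) =
      (\<integral>\<^sup>+ \<omega>. (\<Sum>y\<in>UNIV. indicator (?A y) \<omega> * g y (?Z \<omega>)) \<partial>P x)"
  proof (rule nn_integral_cong)
    fix \<omega> assume "\<omega> \<in> space (P x)"
    then have "indicator (?A y) \<omega> * g y (?Z \<omega>) =
        (if y = X 1 \<omega> then g (X 1 \<omega>) (?Z \<omega>) else 0)" for y
      by (auto simp: indicator_def)
    then show "g (X 1 \<omega>) (?Z \<omega>) = (\<Sum>y\<in>UNIV. indicator (?A y) \<omega> * g y (?Z \<omega>))"
      by simp
  qed
  also have "\<dots> = (\<Sum>y\<in>UNIV. \<integral>\<^sup>+ \<omega>. indicator (?A y) \<omega> * g y (?Z \<omega>) \<partial>P x)"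
    by (rule nn_integral_sum) measurable
  also have "\<dots> = (\<Sum>y\<in>UNIV. ennreal (K $ x $ y) * (\<integral>\<^sup>+ z. g y z \<partial>\<nu>))"
  proof (rule sum.cong[OF refl])
    fix y
    have "(\<integral>\<^sup>+ \<omega>. indicator (?A y) \<omega> * g y (?Z \<omega>) \<partial>P x) =
        (\<integral>\<^sup>+ \<omega>. g y (?Z \<omega>) \<partial>density (P x) (indicator (?A y)))"
      by (rule nn_integral_density[symmetric]) measurable
    also have "\<dots> = (\<integral>\<^sup>+ z. g y z \<partial>distr (density (P x) (indicator (?A y))) borel ?Z)"
      by (rule nn_integral_distr[symmetric])
        (simp_all add: g noise_measurable[of 1, simplified])
    also have "\<dots> = ennreal (K $ x $ y) * (\<integral>\<^sup>+ z. g y z \<partial>\<nu>)"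
      unfolding restrict by (rule nn_integral_scale_measure) (simp add: measurable_cong_sets[OF sets_noise refl])
    finally show "(\<integral>\<^sup>+ \<omega>. indicator (?A y) \<omega> * g y (?Z \<omega>) \<partial>P x) =
        ennreal (K $ x $ y) * (\<integral>\<^sup>+ z. g y z \<partial>\<nu>)" .
  qed
  finally show ?thesis .
qed

lemma one_step_measurable:
  assumes g: "\<And>y. g y \<in> borel_measurable borel"
  shows "(\<lambda>\<omega>. g (X 1 \<omega>) (\<xi> 1 \<omega>, \<eta> 1 \<omega>)) \<in> borel_measurable (P x)"
proof (rule measurable_compose_countable[where f = "\<lambda>y \<omega>. g y (\<xi> 1 \<omega>, \<eta> 1 \<omega>)", OF _ X_measurable])
  show "(\<lambda>\<omega>. g y (\<xi> 1 \<omega>, \<eta> 1 \<omega>)) \<in> borel_measurable (P x)" for y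
    by (rule measurable_compose[OF noise_measurable g]) simp
qed

lemma gamma_fst_measurable [measurable]: "(\<lambda>z::real \<times> real. \<gamma> y (fst z)) \<in> borel_measurable borel"
  by (intro measurable_compose[OF _ gamma_measurable] borel_measurable_continuous_onI continuous_intros)

lemma lam_snd_measurable [measurable]: "(\<lambda>z::real \<times> real. lam y (snd z)) \<in> borel_measurable borel"
  by (intro measurable_compose[OF _ lam_measurable] borel_measurable_continuous_onI continuous_intros)

section \<open>Exponential moments and the eigenvector equation\<close>

text \<open>
  The eigenvector property of \<open>u\<^sub>\<theta>\<close> is available only where \<open>\<chi>(\<cdot>, \<theta>)\<close> is finite.  Finiteness at
  \<open>\<theta>s\<close>, which Cramer's condition provides, propagates to all smaller nonnegative \<open>\<theta>\<close>.
\<close>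

lemma chi_finite_between:
  assumes fin: "chi \<nu> \<gamma> y \<theta>s < \<infinity>" and \<theta>: "0 \<le> \<theta>" "\<theta> \<le> \<theta>s"
  shows "chi \<nu> \<gamma> y \<theta> < \<infinity>"
proof -
  interpret N: prob_space \<nu> by (rule prob_space_noise)
  have exp_le: "exp (\<theta> * r) \<le> 1 + exp (\<theta>s * r)" for r :: real
  proof (cases "r \<ge> 0")
    case True
    then have "exp (\<theta> * r) \<le> exp (\<theta>s * r)" using \<theta> by (simp add: mult_right_mono)
    then show ?thesis by (rule add_increasing[OF zero_le_one])
  next
    case False
    then have "exp (\<theta> * r) \<le> 1" using \<theta> by (simp add: mult_nonneg_nonpos)
    then show ?thesis using exp_gt_zero[of "\<theta>s * r"] by linarith
  qed
  have "mgf \<nu> \<gamma> y \<theta> \<le> (\<integral>\<^sup>+ z. 1 + ennreal (exp (\<theta>s * \<gamma> y (fst z))) \<partial>\<nu>)"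
    unfolding mgf_def
    by (intro nn_integral_mono) (metis exp_le ennreal_leI ennreal_plus ennreal_1 zero_le_one exp_ge_zero)
  also have "\<dots> = 1 + mgf \<nu> \<gamma> y \<theta>s"
    unfolding mgf_def
    by (subst nn_integral_add) (simp_all add: N.emeasure_space_1)
  also have "\<dots> < \<infinity>"
    using fin by (auto simp: chi_def split: if_splits)
  finally show ?thesis by (simp add: chi_def)
qed

lemma mgf_eq_exp_chi:
  assumes "chi \<nu> \<gamma> y \<theta> < \<infinity>"
  shows "mgf \<nu> \<gamma> y \<theta> = ennreal (exp (real_of_ereal (chi \<nu> \<gamma> y \<theta>)))"
proof -
  interpret N: prob_space \<nu> by (rule prob_space_noise)
  have fin: "mgf \<nu> \<gamma> y \<theta> < \<infinity>" using assms by (auto simp: chi_def split: if_splits)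
  have "mgf \<nu> \<gamma> y \<theta> \<noteq> 0"
    unfolding mgf_def by (subst nn_integral_0_iff_AE) (simp_all add: not_le)
  with fin have "0 < enn2real (mgf \<nu> \<gamma> y \<theta>)"
    by (simp add: enn2real_positive_iff zero_less_iff_neq_zero)
  with fin show ?thesis by (simp add: chi_def)
qed

text \<open>
  The eigenvector equation read probabilistically:
  the positive eigenvector is harmonic for the exponentially tilted and normalised step.
\<close>

lemma PF_eigenvector_expectation:
  assumes u: "PF_eigenvectors K \<nu> \<gamma> \<theta>s u" and fin: "\<And>y. chi \<nu> \<gamma> y \<theta> < \<infinity>"
  shows "(\<integral>\<^sup>+ \<omega>. ennreal (u \<theta> $ X 1 \<omega> * exp (\<theta> * \<gamma> (X 1 \<omega>) (\<xi> 1 \<omega>))) \<partial>P x) =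
    ennreal (exp (real_of_ereal (psi K \<nu> \<gamma> \<theta>)) * u \<theta> $ x)"
proof -
  have pos: "\<And>y. 0 < u \<theta> $ y"
    and eigen: "tilted_kernel K \<nu> \<gamma> \<theta> *v u \<theta> = exp (real_of_ereal (psi K \<nu> \<gamma> \<theta>)) *s u \<theta>"
    using u fin by (auto simp: PF_eigenvectors_def)
  have "(\<integral>\<^sup>+ \<omega>. ennreal (u \<theta> $ X 1 \<omega> * exp (\<theta> * \<gamma> (X 1 \<omega>) (\<xi> 1 \<omega>))) \<partial>P x) =
      (\<Sum>y\<in>UNIV. ennreal (K $ x $ y) *
        (\<integral>\<^sup>+ z. ennreal (u \<theta> $ y * exp (\<theta> * \<gamma> y (fst z))) \<partial>\<nu>))"
    using nn_integral_one_step[of "\<lambda>y z. ennreal (u \<theta> $ y * exp (\<theta> * \<gamma> y (fst z)))" x] by simp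
  also have "\<dots> = (\<Sum>y\<in>UNIV. ennreal (tilted_kernel K \<nu> \<gamma> \<theta> $ x $ y * u \<theta> $ y))"
  proof (rule sum.cong[OF refl])
    fix y
    have "(\<integral>\<^sup>+ z. ennreal (u \<theta> $ y * exp (\<theta> * \<gamma> y (fst z))) \<partial>\<nu>) = ennreal (u \<theta> $ y) * mgf \<nu> \<gamma> y \<theta>"
      unfolding mgf_def using pos[of y]
      by (simp add: ennreal_mult less_imp_le nn_integral_cmult)
    then show "ennreal (K $ x $ y) * (\<integral>\<^sup>+ z. ennreal (u \<theta> $ y * exp (\<theta> * \<gamma> y (fst z))) \<partial>\<nu>) =
        ennreal (tilted_kernel K \<nu> \<gamma> \<theta> $ x $ y * u \<theta> $ y)"
      using pos[of y] K_nonneg[of x y]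
      by (simp add: mgf_eq_exp_chi[OF fin] tilted_kernel_def less_imp_le mult_ac flip: ennreal_mult)
  qed
  also have "\<dots> = ennreal ((tilted_kernel K \<nu> \<gamma> \<theta> *v u \<theta>) $ x)"
    using pos K_nonneg
    by (subst sum_ennreal) (auto simp: matrix_vector_mult_def tilted_kernel_def less_imp_le)
  finally show ?thesis by (simp add: eigen)
qed

end

lemma psi_finite_iff: "psi K \<nu> \<gamma> \<theta> < \<infinity> \<longleftrightarrow> (\<forall>y. chi \<nu> \<gamma> y \<theta> < \<infinity>)"
  by (auto simp: psi_def)

text \<open>
  The infimum defining \<open>b0\<close> runs over the open interval only; continuity extends the
  lower bound to the eigenvector at \<open>\<theta>s\<close> itself.
\<close>

lemma eigenvector_ge_Inf:
  fixes u :: "real \<Rightarrow> real ^ 's::finite"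
  assumes \<theta>s: "0 < \<theta>s"
    and pos: "\<And>\<theta> y. \<theta> \<in> {0<..<\<theta>s} \<Longrightarrow> 0 < u \<theta> $ y"
    and cont: "\<And>y. continuous_on {0<..\<theta>s} (\<lambda>\<theta>. u \<theta> $ y)"
    and \<theta>: "\<theta> \<in> {0<..\<theta>s}"
  shows "(INF (\<theta>, y)\<in>{0<..<\<theta>s} \<times> UNIV. u \<theta> $ y) \<le> u \<theta> $ y"
proof -
  let ?m = "INF (\<theta>, y)\<in>{0<..<\<theta>s} \<times> UNIV. u \<theta> $ y"
  have interior: "?m \<le> u \<theta> $ y" if "\<theta> \<in> {0<..<\<theta>s}" for \<theta>
  proof -
    have "bdd_below ((\<lambda>(\<theta>, y). u \<theta> $ y) ` ({0<..<\<theta>s} \<times> UNIV))"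
      using pos by (intro bdd_belowI[of _ 0]) (auto intro: less_imp_le)
    from cINF_lower[OF this, of "(\<theta>, y)"] that show ?thesis by simp
  qed
  show ?thesis
  proof (cases "\<theta> = \<theta>s")
    case True
    have "continuous_on {\<theta>s / 2..\<theta>s} (\<lambda>\<theta>. u \<theta> $ y)"
      by (rule continuous_on_subset[OF cont]) (use \<theta>s in auto)
    then have "((\<lambda>\<theta>. u \<theta> $ y) \<longlongrightarrow> u \<theta>s $ y) (at \<theta>s within {\<theta>s / 2..\<theta>s})"
      using \<theta>s by (simp add: continuous_on_def)
    then have "((\<lambda>\<theta>. u \<theta> $ y) \<longlongrightarrow> u \<theta>s $ y) (at_left \<theta>s)"
      using \<theta>s by (simp add: at_within_Icc_at_left)
    moreover have "\<forall>\<^sub>F \<theta> in at_left \<theta>s. ?m \<le> u \<theta> $ y"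
      using eventually_at_leftI[of 0 \<theta>s "\<lambda>\<theta>. ?m \<le> u \<theta> $ y"] interior \<theta>s by blast
    ultimately show ?thesis
      using True tendsto_lowerbound by fastforce
  qed (use \<theta> interior in auto)
qed

section \<open>The Lyapunov function along one step\<close>

lemma lyap_h_below_barrier:
  assumes "d < 1" "0 < c" "0 < \<Delta>"
  shows "lyap_h u \<theta>s \<rho> c \<Delta> (s, d, x) =
    min ((c * exp s * \<Delta> / (1 - d)) powr (2 * \<theta>s - \<rho>) * u \<theta>s $ x * u (\<theta>s - \<rho>) $ x) 1"
proof -
  have "(c * exp s * (\<Delta> / (1 - d))) powr (2 * \<theta>s - \<rho>) =
      c powr (2 * \<theta>s - \<rho>) * exp ((2 * \<theta>s - \<rho>) * s) * (\<Delta> / (1 - d)) powr (2 * \<theta>s - \<rho>)"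
    using assms by (simp add: powr_mult exp_powr_real mult.commute[of s] del: times_divide_eq_right)
  then show ?thesis using assms by (simp add: lyap_h_def)
qed

lemma lyap_h_le_1: "lyap_h u \<theta>s \<rho> c \<Delta> w \<le> 1"
  by (cases w) (simp add: lyap_h_def)

lemma lyap_h_on_region_C:
  assumes w: "(s, d, x) \<in> region_C u \<theta>s \<rho> c \<Delta>" and pos: "0 < c" "0 < \<Delta>"
  shows "d < 1"
    and "lyap_h u \<theta>s \<rho> c \<Delta> (s, d, x) =
      (c * exp s * \<Delta> / (1 - d)) powr (2 * \<theta>s - \<rho>) * u \<theta>s $ x * u (\<theta>s - \<rho>) $ x"
proof -
  have less: "lyap_h u \<theta>s \<rho> c \<Delta> (s, d, x) < 1" using w by (simp add: region_C_def)
  then show d: "d < 1" by (cases "d < 1") (auto simp: lyap_h_def)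
  show "lyap_h u \<theta>s \<rho> c \<Delta> (s, d, x) =
      (c * exp s * \<Delta> / (1 - d)) powr (2 * \<theta>s - \<rho>) * u \<theta>s $ x * u (\<theta>s - \<rho>) $ x"
    using less unfolding lyap_h_below_barrier[OF d pos] by linarith
qed

text \<open>
  Of the two summands of this bound, the first alone suffices if the step of \<open>D\<close> covers at least
  the fraction \<open>\<beta>\<close> of the distance \<open>1 - d\<close>, because of the cap at 1, and the second alone suffices
  otherwise, because then more than the fraction \<open>1 - \<beta>\<close> of the distance remains.
\<close>

lemma lyap_h_step_le:
  fixes u :: "real \<Rightarrow> real ^ 's::finite"
  assumes pos: "0 < c" "0 < \<Delta>" and d: "d < 1" and \<beta>: "0 < \<beta>" "\<beta> < 1" and l: "0 \<le> l"
    and \<alpha>: "0 < 2 * \<theta>s - \<rho>"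
    and u: "0 < u \<theta>s $ y" "0 < u (\<theta>s - \<rho>) $ y"
  shows "lyap_h u \<theta>s \<rho> c \<Delta> (s + g, d + \<Delta> * l * exp (s + g), y) \<le>
    (c * exp s * \<Delta> / (1 - d)) powr (2 * \<theta>s - \<rho>) * exp ((2 * \<theta>s - \<rho>) * g) *
      (l powr (2 * \<theta>s - \<rho>) / (c * \<beta>) powr (2 * \<theta>s - \<rho>) +
       u \<theta>s $ y * u (\<theta>s - \<rho>) $ y / (1 - \<beta>) powr (2 * \<theta>s - \<rho>))"
    (is "?h \<le> ?A powr ?\<alpha> * ?e * (?L + ?U)")
proof -
  define t where "t = \<Delta> * l * exp (s + g) / (1 - d)"
  have A: "0 < ?A" using pos d by simp
  have e: "exp g powr ?\<alpha> = ?e" by (simp add: exp_powr_real mult.commute)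
  have LU: "0 \<le> ?L" "0 \<le> ?U" using u by simp_all
  show ?thesis
  proof (cases "\<beta> \<le> t")
    case True
    have "?h \<le> 1" by (rule lyap_h_le_1)
    also have "1 \<le> (t / \<beta>) powr ?\<alpha>"
      using True \<beta> \<alpha> by (intro ge_one_powr_ge_zero) auto
    also have "t / \<beta> = ?A * exp g * (l / (c * \<beta>))"
      using pos d \<beta> by (simp add: t_def exp_add field_simps)
    also have "\<dots> powr ?\<alpha> = ?A powr ?\<alpha> * ?e * ?L"
      using A l pos \<beta> by (simp only: powr_mult e powr_divide)
    also have "\<dots> \<le> ?A powr ?\<alpha> * ?e * (?L + ?U)"
      using LU by (intro mult_left_mono) simp_all
    finally show ?thesis .
  next
    case False
    have dist: "1 - (d + \<Delta> * l * exp (s + g)) = (1 - d) * (1 - t)"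
      using d by (simp add: t_def field_simps)
    have shrink: "(1 - d) * (1 - \<beta>) \<le> 1 - (d + \<Delta> * l * exp (s + g))"
      unfolding dist using False d by (intro mult_left_mono) auto
    have gap: "0 < (1 - d) * (1 - \<beta>)" using d \<beta> by simp
    have d1: "d + \<Delta> * l * exp (s + g) < 1" using shrink gap by linarith
    have le: "c * exp (s + g) * \<Delta> / (1 - (d + \<Delta> * l * exp (s + g))) \<le>
        c * exp (s + g) * \<Delta> / ((1 - d) * (1 - \<beta>))"
      by (rule divide_left_mono[OF shrink]) (use pos gap d1 in simp_all)
    have nonneg: "0 \<le> c * exp (s + g) * \<Delta> / (1 - (d + \<Delta> * l * exp (s + g)))"
      using pos d1 by (intro divide_nonneg_pos) simp_all
    have "?h \<le> (c * exp (s + g) * \<Delta> / (1 - (d + \<Delta> * l * exp (s + g)))) powr ?\<alpha> *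
        u \<theta>s $ y * u (\<theta>s - \<rho>) $ y"
      unfolding lyap_h_below_barrier[OF d1 pos] by simp
    also have "\<dots> \<le> (c * exp (s + g) * \<Delta> / ((1 - d) * (1 - \<beta>))) powr ?\<alpha> *
        u \<theta>s $ y * u (\<theta>s - \<rho>) $ y"
      using u \<alpha> le nonneg by (intro mult_right_mono powr_mono2) simp_all
    also have "c * exp (s + g) * \<Delta> / ((1 - d) * (1 - \<beta>)) = ?A * exp g / (1 - \<beta>)"
      by (simp add: exp_add field_simps)
    also have "\<dots> powr ?\<alpha> = ?A powr ?\<alpha> * ?e / (1 - \<beta>) powr ?\<alpha>"
      using A \<beta> by (simp only: powr_mult e powr_divide)
    also have "\<dots> * u \<theta>s $ y * u (\<theta>s - \<rho>) $ y = ?A powr ?\<alpha> * ?e * ?U" by simp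
    also have "\<dots> \<le> ?A powr ?\<alpha> * ?e * (?L + ?U)"
      using LU by (intro mult_left_mono) simp_all
    finally show ?thesis .
  qed
qed

section \<open>The Lyapunov inequality\<close>

theorem proposition1:
  fixes K :: "real ^ 's ^ 's::finite"
    and \<nu> :: "(real \<times> real) measure"
    and \<gamma> lam :: "'s \<Rightarrow> real \<Rightarrow> real"
    and P :: "'s \<Rightarrow> 'w measure"
    and X :: "nat \<Rightarrow> 'w \<Rightarrow> 's"
    and \<xi> \<eta> :: "nat \<Rightarrow> 'w \<Rightarrow> real"
    and u :: "real \<Rightarrow> real ^ 's"
    and \<theta>s \<mu> b0 b1 b2 B1 B2 :: real
    and \<rho> c :: "real \<Rightarrow> real"
    and I :: "real set"
  assumes model: "nominal_model K \<nu> \<gamma> lam P X \<xi> \<eta>"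
    and eigenvectors: "PF_eigenvectors K \<nu> \<gamma> \<theta>s u"
    and irreducible: "irreducible_chain K"
    and exp_moments: "\<exists>N. open N \<and> 0 \<in> N \<and> (SUP x. SUP \<theta>\<in>N. mgf \<nu> \<gamma> x \<theta>) < \<infinity>"
    and cramer: "\<theta>s > 0" "psi K \<nu> \<gamma> \<theta>s = 0" "\<exists>\<theta>>\<theta>s. psi K \<nu> \<gamma> \<theta> < \<infinity>"
    and lam_moments: "\<And>\<alpha>. \<alpha> > 0 \<Longrightarrow>
          (SUP x. \<integral>\<^sup>+ \<omega>. ennreal (lam (X 1 \<omega>) (\<eta> 1 \<omega>) powr \<alpha>) \<partial>P x) < \<infinity>"
    and b0: "0 < 1 / (INF (\<theta>, x)\<in>{0<..<\<theta>s} \<times> UNIV. u \<theta> $ x)\<^sup>2"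
            "1 / (INF (\<theta>, x)\<in>{0<..<\<theta>s} \<times> UNIV. u \<theta> $ x)\<^sup>2 \<le> b0"
    and mu: "((\<lambda>\<theta>. real_of_ereal (psi K \<nu> \<gamma> \<theta>)) has_real_derivative \<mu>) (at \<theta>s)" "\<mu> > 0"
    and b1: "b1 > 0"
            "\<And>\<delta>. \<delta> \<in> {0<..<\<theta>s} \<Longrightarrow>
               exp (real_of_ereal (psi K \<nu> \<gamma> (\<theta>s - \<delta>))) \<le> 1 - \<delta> * \<mu> + b1 * \<delta>\<^sup>2"
    and b2: "b2 > 0"
            "(SUP x. SUP \<delta>\<in>{0<..<\<theta>s}. \<integral>\<^sup>+ \<omega>. ennreal (lam (X 1 \<omega>) (\<eta> 1 \<omega>) powr (2 * \<theta>s - \<delta>)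
                * exp ((\<theta>s - \<delta>) * \<gamma> (X 1 \<omega>) (\<xi> 1 \<omega>))) \<partial>P x) \<le> ennreal b2"
    and B: "B1 > 0" "B2 > 0"
    and I: "I \<subseteq> {0<..}"
    and rho_tendsto: "filterlim \<rho> (at_right 0) (at 0 within I)"
    and rho: "\<And>\<Delta>. \<Delta> \<in> I \<Longrightarrow> \<rho> \<Delta> \<in> {0<..<\<theta>s}"
    and c: "\<And>\<Delta>. \<Delta> \<in> I \<Longrightarrow>
              c \<Delta> = B2 / B1 * \<rho> \<Delta> powr (- (1 + 1 / (2 * \<theta>s - \<rho> \<Delta>)))"
    and B1_rho: "\<And>\<Delta>. \<Delta> \<in> I \<Longrightarrow> B1 * \<rho> \<Delta> < 1"
    and selection: "\<And>\<Delta>. \<Delta> \<in> I \<Longrightarrow>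
              b0 * b2 * \<rho> \<Delta> / B2 powr (2 * \<theta>s - \<rho> \<Delta>)
              + (1 - \<rho> \<Delta> * \<mu> + b1 * (\<rho> \<Delta>)\<^sup>2) / (1 - B1 * \<rho> \<Delta>) powr (2 * \<theta>s - \<rho> \<Delta>) \<le> 1"
  shows "\<forall>\<Delta>\<in>I. \<forall>(s, d, x) \<in> region_C u \<theta>s (\<rho> \<Delta>) (c \<Delta>) \<Delta>.
           (\<integral>\<^sup>+ \<omega>. ennreal (ratio_r u \<theta>s (\<rho> \<Delta>) (c \<Delta>) \<Delta> (s, d, x)
                             (walk_W \<gamma> lam X \<xi> \<eta> \<Delta> s d 1 \<omega>)
                           * lyap_h u \<theta>s (\<rho> \<Delta>) (c \<Delta>) \<Delta>
                             (walk_W \<gamma> lam X \<xi> \<eta> \<Delta> s d 1 \<omega>)) \<partial>P x)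
           \<le> ennreal (lyap_h u \<theta>s (\<rho> \<Delta>) (c \<Delta>) \<Delta> (s, d, x))"
proof (intro ballI, clarify)
  fix \<Delta> s d x
  assume \<Delta>: "\<Delta> \<in> I" and w: "(s, d, x) \<in> region_C u \<theta>s (\<rho> \<Delta>) (c \<Delta>) \<Delta>"
  interpret nominal_model K \<nu> \<gamma> lam P X \<xi> \<eta> by (rule model)
  define r where "r = \<rho> \<Delta>"
  define \<alpha> where "\<alpha> = 2 * \<theta>s - r"
  define \<beta> where "\<beta> = B1 * r"
  define A where "A = c \<Delta> * exp s * \<Delta> / (1 - d)"
  have r: "0 < r" "r < \<theta>s" using rho[OF \<Delta>] by (auto simp: r_def)
  have \<alpha>: "0 < \<alpha>" using r by (simp add: \<alpha>_def)
  have \<beta>: "0 < \<beta>" "\<beta> < 1" using B r B1_rho[OF \<Delta>] by (auto simp: \<beta>_def r_def)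
  have \<Delta>_pos: "0 < \<Delta>" using I \<Delta> by auto
  have c_pos: "0 < c \<Delta>" using c[OF \<Delta>] B r by (simp add: r_def)
  note d = lyap_h_on_region_C(1)[OF w c_pos \<Delta>_pos]
  note h = lyap_h_on_region_C(2)[OF w c_pos \<Delta>_pos, folded r_def, folded \<alpha>_def A_def]

  have chi_fin: "chi \<nu> \<gamma> y \<theta> < \<infinity>" if "\<theta> \<in> {0<..\<theta>s}" for y \<theta>
  proof -
    have "psi K \<nu> \<gamma> \<theta>s < \<infinity>" using cramer by simp
    then have "chi \<nu> \<gamma> y \<theta>s < \<infinity>" by (simp only: psi_finite_iff)
    then show ?thesis by (rule chi_finite_between) (use that in auto)
  qed
  have u_pos: "0 < u \<theta> $ y" if "\<theta> \<in> {0<..\<theta>s}" for y \<theta>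
    using eigenvectors chi_fin[OF that] by (auto simp: PF_eigenvectors_def)
  let ?m = "INF (\<theta>, y)\<in>{0<..<\<theta>s} \<times> UNIV. u \<theta> $ y"
  have m_le: "?m \<le> u \<theta> $ y" if "\<theta> \<in> {0<..\<theta>s}" for y \<theta>
    by (rule eigenvector_ge_Inf[OF cramer(1) _ _ that])
      (use eigenvectors u_pos in \<open>auto simp: PF_eigenvectors_def\<close>)
  have "0 \<le> ?m" by (rule cINF_greatest) (use cramer(1) u_pos in \<open>auto intro: less_imp_le\<close>)
  moreover have "?m \<noteq> 0" using b0(1) by auto
  ultimately have m_pos: "0 < ?m" by linarith
  have b0_nonneg: "0 \<le> b0" using b0 by linarith
  have inverse_u_le: "1 / u \<theta>s $ y \<le> b0 * u (\<theta>s - r) $ x" for y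
  proof -
    have "?m\<^sup>2 \<le> u \<theta>s $ y * u (\<theta>s - r) $ x"
      unfolding power2_eq_square using m_pos m_le u_pos[of \<theta>s y] r cramer(1) by (intro mult_mono) (auto intro: less_imp_le)
    then have "1 \<le> b0 * (u \<theta>s $ y * u (\<theta>s - r) $ x)"
      using b0(2) m_pos b0_nonneg
      by (smt (verit, best) mult_left_mono pos_divide_le_eq zero_less_power)
    then show ?thesis using u_pos[of \<theta>s y] cramer(1) by (simp add: field_simps)
  qed

  let ?u0 = "u \<theta>s $ x" and ?u1 = "u (\<theta>s - r) $ x"
  have u01: "0 < ?u0" "0 < ?u1" using u_pos[of \<theta>s x] u_pos[of "\<theta>s - r" x] r by auto
  let ?g = "\<lambda>\<omega>. \<gamma> (X 1 \<omega>) (\<xi> 1 \<omega>)" and ?l = "\<lambda>\<omega>. lam (X 1 \<omega>) (\<eta> 1 \<omega>)"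
  let ?large = "\<lambda>\<omega>. ?l \<omega> powr \<alpha> * exp ((\<theta>s - r) * ?g \<omega>)"
  let ?small = "\<lambda>\<omega>. u (\<theta>s - r) $ X 1 \<omega> * exp ((\<theta>s - r) * ?g \<omega>)"
  define p where "p = A powr \<alpha> * ?u0 * (b0 * ?u1 / (c \<Delta> * \<beta>) powr \<alpha>)"
  define q where "q = A powr \<alpha> * ?u0 / (1 - \<beta>) powr \<alpha>"
  let ?W = "walk_W \<gamma> lam X \<xi> \<eta> \<Delta> s d 1"
  have pq: "0 \<le> p" "0 \<le> q" using u01 b0_nonneg by (simp_all add: p_def q_def)

  have pointwise: "ratio_r u \<theta>s r (c \<Delta>) \<Delta> (s, d, x) (?W \<omega>) * lyap_h u \<theta>s r (c \<Delta>) \<Delta> (?W \<omega>)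
      \<le> p * ?large \<omega> + q * ?small \<omega>" for \<omega>
  proof -
    define y where "y = X 1 \<omega>"
    define g where "g = ?g \<omega>"
    define l where "l = ?l \<omega>"
    have uy: "0 < u \<theta>s $ y" "0 < u (\<theta>s - r) $ y" using u_pos r by auto
    have W: "?W \<omega> = (s + g, d + \<Delta> * l * exp (s + g), y)"
      by (simp add: walk_W_def y_def g_def l_def)
    have ratio: "ratio_r u \<theta>s r (c \<Delta>) \<Delta> (s, d, x) (?W \<omega>) = ?u0 / u \<theta>s $ y * exp (- \<theta>s * g)"
      unfolding W using w by (simp add: ratio_r_def r_def)
    have tilt: "exp (- \<theta>s * g) * exp (\<alpha> * g) = exp ((\<theta>s - r) * g)"
      by (simp add: \<alpha>_def algebra_simps flip: exp_add)
    have "?u0 / u \<theta>s $ y * exp (- \<theta>s * g) * lyap_h u \<theta>s r (c \<Delta>) \<Delta> (?W \<omega>) \<le>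
        ?u0 / u \<theta>s $ y * exp (- \<theta>s * g) * (A powr \<alpha> * exp (\<alpha> * g) *
          (l powr \<alpha> / (c \<Delta> * \<beta>) powr \<alpha> + u \<theta>s $ y * u (\<theta>s - r) $ y / (1 - \<beta>) powr \<alpha>))"
      unfolding W A_def \<alpha>_def
      using u01 uy \<alpha> lam_nonneg
      by (intro mult_left_mono lyap_h_step_le[OF c_pos \<Delta>_pos d \<beta>]) (auto simp: \<alpha>_def l_def)
    also have "\<dots> = (exp (- \<theta>s * g) * exp (\<alpha> * g)) * (A powr \<alpha> * ?u0 *
        (1 / u \<theta>s $ y * (l powr \<alpha> / (c \<Delta> * \<beta>) powr \<alpha>) + u (\<theta>s - r) $ y / (1 - \<beta>) powr \<alpha>))"
      using uy by (simp add: distrib_left mult_ac)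
    also have "\<dots> \<le> exp ((\<theta>s - r) * g) * (A powr \<alpha> * ?u0 *
        (b0 * ?u1 * (l powr \<alpha> / (c \<Delta> * \<beta>) powr \<alpha>) + u (\<theta>s - r) $ y / (1 - \<beta>) powr \<alpha>))"
      unfolding tilt using u01 inverse_u_le
      by (intro mult_left_mono add_mono mult_right_mono order_refl) auto
    also have "\<dots> = p * ?large \<omega> + q * ?small \<omega>"
      by (simp add: p_def q_def distrib_left mult_ac y_def g_def l_def)
    finally show ?thesis unfolding ratio .
  qed

  have large_measurable: "(\<lambda>\<omega>. ennreal (?large \<omega>)) \<in> borel_measurable (P x)"
    using one_step_measurable[of "\<lambda>y z. ennreal (lam y (snd z) powr \<alpha> * exp ((\<theta>s - r) * \<gamma> y (fst z)))" x]
    by simp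
  have small_measurable: "(\<lambda>\<omega>. ennreal (?small \<omega>)) \<in> borel_measurable (P x)"
    using one_step_measurable[of "\<lambda>y z. ennreal (u (\<theta>s - r) $ y * exp ((\<theta>s - r) * \<gamma> y (fst z)))" x]
    by simp
  have large: "(\<integral>\<^sup>+ \<omega>. ennreal (?large \<omega>) \<partial>P x) \<le> ennreal b2"
    unfolding \<alpha>_def
    by (rule order_trans[OF _ b2(2)], rule SUP_upper2[OF UNIV_I[of x]], rule SUP_upper)
      (use r in simp)
  have small: "(\<integral>\<^sup>+ \<omega>. ennreal (?small \<omega>) \<partial>P x) =
      ennreal (exp (real_of_ereal (psi K \<nu> \<gamma> (\<theta>s - r))) * ?u1)"
    by (rule PF_eigenvector_expectation[OF eigenvectors chi_fin]) (use r in auto)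

  have large_nonneg: "0 \<le> ?large \<omega>" for \<omega> by simp
  have small_nonneg: "0 \<le> ?small \<omega>" for \<omega>
    using u_pos[of "\<theta>s - r"] r by (simp add: less_imp_le)
  \<comment> \<open>The exponent of \<open>\<rho>\<close> in the definition of \<open>c\<close> is the one for which \<open>(c * \<beta>)\<^sup>\<alpha>\<close> becomes \<open>B2\<^sup>\<alpha> / \<rho>\<close>.\<close>
  have "c \<Delta> * \<beta> = B2 * r powr (- (1 / \<alpha>))"
  proof -
    have "r powr (- (1 + 1 / \<alpha>)) * r = r powr (- (1 / \<alpha>))"
      using r powr_add[of r "- (1 + 1 / \<alpha>)" 1] by simp
    moreover have "c \<Delta> * \<beta> = B2 * (r powr (- (1 + 1 / \<alpha>)) * r)"
      using c[OF \<Delta>] B by (simp add: \<beta>_def flip: r_def \<alpha>_def)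
    ultimately show ?thesis by simp
  qed
  then have c\<beta>: "(c \<Delta> * \<beta>) powr \<alpha> = B2 powr \<alpha> / r"
    using r B \<alpha> by (simp add: powr_divide powr_powr powr_minus_divide)

  have "(\<integral>\<^sup>+ \<omega>. ennreal (ratio_r u \<theta>s r (c \<Delta>) \<Delta> (s, d, x) (?W \<omega>)
        * lyap_h u \<theta>s r (c \<Delta>) \<Delta> (?W \<omega>)) \<partial>P x)
      \<le> (\<integral>\<^sup>+ \<omega>. ennreal p * ennreal (?large \<omega>) + ennreal q * ennreal (?small \<omega>) \<partial>P x)"
  proof (rule nn_integral_mono)
    fix \<omega>
    have "ennreal p * ennreal (?large \<omega>) + ennreal q * ennreal (?small \<omega>)
        = ennreal (p * ?large \<omega> + q * ?small \<omega>)"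
      using pq large_nonneg[of \<omega>] small_nonneg[of \<omega>]
      by (metis ennreal_plus ennreal_mult mult_nonneg_nonneg)
    with pointwise[of \<omega>] show "ennreal (ratio_r u \<theta>s r (c \<Delta>) \<Delta> (s, d, x) (?W \<omega>)
        * lyap_h u \<theta>s r (c \<Delta>) \<Delta> (?W \<omega>))
      \<le> ennreal p * ennreal (?large \<omega>) + ennreal q * ennreal (?small \<omega>)"
      by (metis ennreal_leI)
  qed
  also have "\<dots> = ennreal p * (\<integral>\<^sup>+ \<omega>. ennreal (?large \<omega>) \<partial>P x)
      + ennreal q * (\<integral>\<^sup>+ \<omega>. ennreal (?small \<omega>) \<partial>P x)"
    by (simp only: nn_integral_add nn_integral_cmult large_measurable small_measurable
        borel_measurable_times_ennreal borel_measurable_const)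
  also have "\<dots> \<le> ennreal p * ennreal b2
      + ennreal q * ennreal (exp (real_of_ereal (psi K \<nu> \<gamma> (\<theta>s - r))) * ?u1)"
    unfolding small by (intro add_right_mono mult_left_mono large) simp
  also have "\<dots> = ennreal (p * b2 + q * (exp (real_of_ereal (psi K \<nu> \<gamma> (\<theta>s - r))) * ?u1))"
    using pq b2(1) u01
    by (subst ennreal_plus) (simp_all only: ennreal_mult mult_nonneg_nonneg less_imp_le exp_ge_zero)
  also have "\<dots> \<le> ennreal (A powr \<alpha> * ?u0 * ?u1)"
  proof (rule ennreal_leI)
    have "exp (real_of_ereal (psi K \<nu> \<gamma> (\<theta>s - r))) \<le> 1 - r * \<mu> + b1 * r\<^sup>2"
      using b1(2) r by simp
    then have "b0 * b2 * r / B2 powr \<alpha>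
        + exp (real_of_ereal (psi K \<nu> \<gamma> (\<theta>s - r))) / (1 - \<beta>) powr \<alpha>
        \<le> b0 * b2 * r / B2 powr \<alpha> + (1 - r * \<mu> + b1 * r\<^sup>2) / (1 - \<beta>) powr \<alpha>"
      by (intro add_left_mono divide_right_mono) simp_all
    also have "\<dots> \<le> 1" using selection[OF \<Delta>] by (simp add: r_def \<alpha>_def \<beta>_def)
    finally have "A powr \<alpha> * ?u0 * ?u1 * (b0 * b2 * r / B2 powr \<alpha>
        + exp (real_of_ereal (psi K \<nu> \<gamma> (\<theta>s - r))) / (1 - \<beta>) powr \<alpha>) \<le> A powr \<alpha> * ?u0 * ?u1"
      using u01 by (intro mult_left_le) simp_all
    moreover have "p * b2 + q * (exp (real_of_ereal (psi K \<nu> \<gamma> (\<theta>s - r))) * ?u1) =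
        A powr \<alpha> * ?u0 * ?u1 * (b0 * b2 * r / B2 powr \<alpha>
        + exp (real_of_ereal (psi K \<nu> \<gamma> (\<theta>s - r))) / (1 - \<beta>) powr \<alpha>)"
      unfolding p_def q_def c\<beta> by (simp add: distrib_left mult_ac)
    ultimately show "p * b2 + q * (exp (real_of_ereal (psi K \<nu> \<gamma> (\<theta>s - r))) * ?u1)
        \<le> A powr \<alpha> * ?u0 * ?u1" by simp
  qed
  finally show "(\<integral>\<^sup>+ \<omega>. ennreal (ratio_r u \<theta>s (\<rho> \<Delta>) (c \<Delta>) \<Delta> (s, d, x) (?W \<omega>)
        * lyap_h u \<theta>s (\<rho> \<Delta>) (c \<Delta>) \<Delta> (?W \<omega>)) \<partial>P x)
      \<le> ennreal (lyap_h u \<theta>s (\<rho> \<Delta>) (c \<Delta>) \<Delta> (s, d, x))"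
    unfolding h[symmetric] by (simp add: r_def)
qed

end
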